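(* Let $n$ be a positive integer and $K$ a skew field. Every singular $n$-by-$n$ matrix with entries in $K$ is a product of at most $n$ idempotent $n$-by-$n$ matrices over $K$ of rank $n-1$.
   Context: A matrix is singular if it is a zero divisor in the ring $\mathcal{M}_n(K)$ of $n$-by-$n$ matrices over $K$. *)

theory Defs
  imports "Jordan_Normal_Form.Matrix"
begin

text \<open>
  A zero divisor may be one on either side, and \<open>0\<close> counts as a zero divisor of a nontrivial
  ring: the only singular 1-by-1 matrix over a skew field is \<open>0\<close>.
\<close>

definition zero_divisor :: "('r, 'm) ring_scheme \<Rightarrow> 'r \<Rightarrow> bool" where
  "zero_divisor R a \<longleftrightarrow> a \<in> carrier R \<and>
     (\<exists>b \<in> carrier R. b \<noteq> \<zero>\<^bsub>R\<^esub> \<and> (a \<otimes>\<^bsub>R\<^esub> b = \<zero>\<^bsub>R\<^esub> \<or> b \<otimes>\<^bsub>R\<^esub> a = \<zero>\<^bsub>R\<^esub>))"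

definition singular_mat :: "nat \<Rightarrow> 'a::division_ring mat \<Rightarrow> bool" where
  "singular_mat n A \<longleftrightarrow> zero_divisor (ring_mat TYPE('a) n ()) A"

text \<open>
  Columns are vectors of the right vector space \<open>K\<^sup>n\<close> (scalars multiply on the right), so that
  matrices act linearly from the left. The vector space theory of the library assumes commutative
  scalars; the notions below are its counterparts over a skew field, for finite sets \<open>B\<close>.
\<close>

definition right_lincomb :: "nat \<Rightarrow> ('a::division_ring vec \<Rightarrow> 'a) \<Rightarrow> 'a vec set \<Rightarrow> 'a vec" where
  "right_lincomb n c B = vec n (\<lambda>i. \<Sum>v\<in>B. v $ i * c v)"

definition right_span :: "nat \<Rightarrow> 'a::division_ring vec set \<Rightarrow> 'a vec set" where
  "right_span n B = {right_lincomb n c B | c. True}"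

definition right_independent :: "nat \<Rightarrow> 'a::division_ring vec set \<Rightarrow> bool" where
  "right_independent n B \<longleftrightarrow>
     (\<forall>c. right_lincomb n c B = 0\<^sub>v n \<longrightarrow> (\<forall>v\<in>B. c v = 0))"

definition right_basis :: "nat \<Rightarrow> 'a::division_ring vec set \<Rightarrow> 'a vec set \<Rightarrow> bool" where
  "right_basis n V B \<longleftrightarrow>
     finite B \<and> B \<subseteq> carrier_vec n \<and> right_independent n B \<and> right_span n B = V"

definition right_dim :: "nat \<Rightarrow> 'a::division_ring vec set \<Rightarrow> nat" where
  "right_dim n V = card (SOME B. right_basis n V B)"

definition mat_rank :: "'a::division_ring mat \<Rightarrow> nat" where
  "mat_rank A = right_dim (dim_row A) (right_span (dim_row A) (set (cols A)))"

definition idempotent_mat :: "nat \<Rightarrow> 'a::division_ring mat \<Rightarrow> bool" where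
  "idempotent_mat n E \<longleftrightarrow> E \<in> carrier_mat n n \<and> E * E = E"

end

theory Submission
  imports Defs "HOL-Library.Function_Algebras"
begin

text \<open>
  Write \<open>A = 1 - \<Sum> p\<^sub>l f\<^sub>l\<close> with \<open>k\<close> columns \<open>p\<^sub>l\<close> and \<open>k\<close> rows \<open>f\<^sub>l\<close>; this is possible with \<open>k = n\<close>.
  By induction on \<open>k\<close>, a singular such \<open>A\<close> is a product of at most \<open>k\<close> idempotents \<open>1 - u \<phi>\<close>
  with \<open>\<phi> u = 1\<close>. If \<open>A u = 0\<close> and \<open>\<phi> u = 1\<close>, then \<open>A = A' (1 - u \<phi>)\<close> for every \<open>A' = A + w \<phi>\<close>.
  Taking \<open>\<phi>\<close> in the span of the \<open>f\<^sub>l\<close> and \<open>w = x - A x\<close> with \<open>\<phi> x = 1\<close>, the matrix \<open>A'\<close> fixes \<open>x\<close> and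
  everything in the common kernel of the \<open>f\<^sub>l\<close>, so \<open>k - 1\<close> terms suffice for \<open>A'\<close>. It remains to keep
  \<open>A'\<close> singular: choose \<open>x\<close> in the image of \<open>A\<close>, so that the image of \<open>A'\<close> does not grow, unless
  that image is already fixed by \<open>A\<close>; then \<open>A\<close> is idempotent and \<open>x = u\<close> works as long as \<open>k > 1\<close>.
\<close>

section \<open>Perturbations of the identity by operators of finite rank\<close>

text \<open>Vectors fill a whole type and no dimension is assumed. Scalars act from the right, so
  that operators and functionals, written on the left, are linear without commutativity.\<close>

locale right_space =
  fixes smul :: "'v::ab_group_add \<Rightarrow> 'a::division_ring \<Rightarrow> 'v"  (infixl "\<cdot>" 75)
  assumes smul_add_left: "(x + y) \<cdot> c = x \<cdot> c + y \<cdot> c"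
    and smul_add_right: "x \<cdot> (a + b) = x \<cdot> a + x \<cdot> b"
    and smul_mult: "x \<cdot> (a * b) = x \<cdot> a \<cdot> b"
    and smul_one: "x \<cdot> 1 = x"
begin

lemma smul_zero_right [simp]: "x \<cdot> 0 = 0"
  using smul_add_right[of x 0 0] by simp

lemma smul_zero_left [simp]: "0 \<cdot> c = 0"
  using smul_add_left[of 0 0 c] by simp

lemma smul_minus_left: "(- x) \<cdot> c = - (x \<cdot> c)"
  by (metis add.right_inverse minus_unique smul_add_left smul_zero_left)

lemma smul_minus_right: "x \<cdot> (- c) = - (x \<cdot> c)"
  by (metis add.right_inverse minus_unique smul_add_right smul_zero_right)

lemma smul_diff_left: "(x - y) \<cdot> c = x \<cdot> c - y \<cdot> c"
  by (metis diff_conv_add_uminus smul_add_left smul_minus_left)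

lemma smul_diff_right: "x \<cdot> (a - b) = x \<cdot> a - x \<cdot> b"
  by (metis diff_conv_add_uminus smul_add_right smul_minus_right)

lemma smul_sum_left: "(\<Sum>l\<in>L. g l) \<cdot> c = (\<Sum>l\<in>L. g l \<cdot> c)"
  by (induction L rule: infinite_finite_induct) (auto simp: smul_add_left)

lemma smul_sum_right: "x \<cdot> (\<Sum>l\<in>L. g l) = (\<Sum>l\<in>L. x \<cdot> g l)"
  by (induction L rule: infinite_finite_induct) (auto simp: smul_add_right)

section \<open>Linear functionals and subspaces\<close>

definition functional :: "('v \<Rightarrow> 'a) \<Rightarrow> bool" where
  "functional f \<longleftrightarrow> (\<forall>x y. f (x + y) = f x + f y) \<and> (\<forall>x c. f (x \<cdot> c) = f x * c)"

lemma functional_add: "functional f \<Longrightarrow> f (x + y) = f x + f y"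
  and functional_smul: "functional f \<Longrightarrow> f (x \<cdot> c) = f x * c"
  by (auto simp: functional_def)

lemma functional_zero: "functional f \<Longrightarrow> f 0 = 0"
  using functional_add[of f 0 0] by simp

lemma functional_diff: "functional f \<Longrightarrow> f (x - y) = f x - f y"
  by (metis add_diff_cancel diff_add_cancel functional_add)

lemma functional_sum: "functional f \<Longrightarrow> f (\<Sum>l\<in>L. g l) = (\<Sum>l\<in>L. f (g l))"
  by (induction L rule: infinite_finite_induct) (auto simp: functional_add functional_zero)

text \<open>Coefficients stand to the left of the values, away from the right action of the scalars,
  so functionals form a left vector space.\<close>

lemma functional_lincomb:
  assumes "\<And>l. l \<in> L \<Longrightarrow> functional (f l)"
  shows "functional (\<lambda>x. \<Sum>l\<in>L. c l * f l x)"
  using assms by (auto simp: functional_def sum.distrib distrib_left sum_distrib_right mult.assoc)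

lemma functional_combine:
  assumes "functional f" and "functional g"
  shows "functional (\<lambda>x. f x - c * g x)"
  using assms by (auto simp: functional_def algebra_simps)

definition subspace :: "'v set \<Rightarrow> bool" where
  "subspace W \<longleftrightarrow> 0 \<in> W \<and> (\<forall>x\<in>W. \<forall>y\<in>W. x + y \<in> W) \<and> (\<forall>x\<in>W. \<forall>c. x \<cdot> c \<in> W)"

lemma subspace_smul: "subspace W \<Longrightarrow> x \<in> W \<Longrightarrow> x \<cdot> c \<in> W"
  by (auto simp: subspace_def)

lemma subspace_diff: "subspace W \<Longrightarrow> x \<in> W \<Longrightarrow> y \<in> W \<Longrightarrow> x - y \<in> W"
  by (metis diff_conv_add_uminus smul_minus_right smul_one subspace_def)

lemma subspace_sum:
  "subspace W \<Longrightarrow> (\<And>l. l \<in> L \<Longrightarrow> g l \<in> W) \<Longrightarrow> (\<Sum>l\<in>L. g l) \<in> W"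
  by (induction L rule: infinite_finite_induct) (auto simp: subspace_def)

section \<open>The operators \<open>1 - u \<phi>\<close> and the identity minus finitely many
  rank-one terms\<close>

definition corank_one_idem :: "'v \<times> ('v \<Rightarrow> 'a) \<Rightarrow> 'v \<Rightarrow> 'v" where
  "corank_one_idem e x = x - fst e \<cdot> snd e x"

text \<open>An operator has many representations of this kind; the number of terms,
  \<open>card L\<close>, is what the induction below decreases.\<close>

definition id_minus :: "'i set \<Rightarrow> ('i \<Rightarrow> 'v) \<Rightarrow> ('i \<Rightarrow> 'v \<Rightarrow> 'a) \<Rightarrow> 'v \<Rightarrow> 'v" where
  "id_minus L p f x = x - (\<Sum>l\<in>L. p l \<cdot> f l x)"

lemma id_minus_add:
  "(\<And>l. l \<in> L \<Longrightarrow> functional (f l)) \<Longrightarrow> id_minus L p f (x + y) = id_minus L p f x + id_minus L p f y"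
  by (simp add: id_minus_def functional_add smul_add_right sum.distrib)

lemma id_minus_diff:
  "(\<And>l. l \<in> L \<Longrightarrow> functional (f l)) \<Longrightarrow> id_minus L p f (x - y) = id_minus L p f x - id_minus L p f y"
  by (simp add: id_minus_def functional_diff smul_diff_right sum_subtractf)

lemma id_minus_smul:
  "(\<And>l. l \<in> L \<Longrightarrow> functional (f l)) \<Longrightarrow> id_minus L p f (x \<cdot> c) = id_minus L p f x \<cdot> c"
  by (simp add: id_minus_def functional_smul smul_mult smul_diff_left smul_sum_left)

text \<open>The relation is solved for \<open>f j\<close>; substituting the result distributes the
  column \<open>p j\<close> over the remaining columns.\<close>

lemma id_minus_eliminate:
  assumes "finite L" and "j \<in> L" and "c j \<noteq> 0" and dep: "\<And>x. (\<Sum>l\<in>L. c l * f l x) = 0"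
  shows "id_minus L p f = id_minus (L - {j}) (\<lambda>l. p l - p j \<cdot> (inverse (c j) * c l)) f"
proof
  fix x
  have "c j * f j x + (\<Sum>l\<in>L - {j}. c l * f l x) = 0"
    using dep[of x] assms by (simp add: sum.remove)
  then have "inverse (c j) * (c j * f j x) = inverse (c j) * - (\<Sum>l\<in>L - {j}. c l * f l x)"
    by (intro arg_cong[where f = "(*) (inverse (c j))"]) (simp only: eq_neg_iff_add_eq_0)
  then have fj: "f j x = - (\<Sum>l\<in>L - {j}. inverse (c j) * c l * f l x)"
    using \<open>c j \<noteq> 0\<close> by (simp add: sum_distrib_left mult.assoc flip: mult.assoc[of "inverse (c j)" "c j"])
  show "id_minus L p f x = id_minus (L - {j}) (\<lambda>l. p l - p j \<cdot> (inverse (c j) * c l)) f x"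
    using assms(1,2)
    by (simp add: id_minus_def sum.remove fj smul_minus_right smul_sum_right smul_diff_left
        sum_subtractf smul_mult)
qed

text \<open>
  The perturbed operator is \<open>T\<close> applied to \<open>v + z \<phi>(v)\<close>, so a kernel vector \<open>v\<close> is found by making
  \<open>v + z \<phi>(v)\<close> equal to \<open>0\<close> or \<open>u\<close>.
\<close>

lemma perturbation_singular:
  assumes T: "\<And>x y. T (x + y) = T x + T y" "\<And>x c. T (x \<cdot> c) = T x \<cdot> c"
    and "functional \<phi>" and "T u = 0" and "\<phi> u = 1"
  shows "\<exists>v. v \<noteq> 0 \<and> T v + T z \<cdot> \<phi> v = 0"
proof (cases "1 + \<phi> z = 0")
  case True
  then have "\<phi> z = - 1"
    by (simp add: eq_neg_iff_add_eq_0 add.commute)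
  then have "z \<noteq> 0" "T z + T z \<cdot> \<phi> z = 0"
    using functional_zero[OF \<open>functional \<phi>\<close>] by (auto simp: smul_minus_right smul_one)
  then show ?thesis by blast
next
  case False
  \<comment> \<open>Applying \<open>\<phi>\<close> to the equation
    \<open>v + z \<phi>(v) = u\<close> gives \<open>(1 + \<phi> z) \<phi>(v) = 1\<close>, which
    forces this value of \<open>\<phi> v\<close>.\<close>
  define c where "c = inverse (1 + \<phi> z)"
  have c: "c \<noteq> 0" "c + \<phi> z * c = 1"
    using False right_inverse[OF False] left_inverse[OF False]
    by (auto simp: c_def distrib_right)
  define v where "v = u - z \<cdot> c"
  have \<phi>v: "\<phi> v = c"
    using c assms by (simp add: v_def functional_diff functional_smul algebra_simps)
  have "T v + T (z \<cdot> c) = T u"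
    using T(1)[of v "z \<cdot> c"] by (simp add: v_def)
  then have "T v + T z \<cdot> \<phi> v = 0"
    using assms by (simp add: \<phi>v T(2))
  moreover have "v \<noteq> 0"
    using \<phi>v c(1) functional_zero[OF \<open>functional \<phi>\<close>] by auto
  ultimately show ?thesis by blast
qed

text \<open>A vector space is not the union of two proper subspaces: one of \<open>f i\<close>,
  \<open>f j\<close> and \<open>f i + f j\<close> is nonzero at both \<open>u\<close> and
  \<open>x\<close>.\<close>

lemma common_nonvanishing:
  assumes "finite L" and "i \<in> L" "f i u \<noteq> 0" and "j \<in> L" "f j x \<noteq> (0::'a)"
  shows "\<exists>c. (\<Sum>l\<in>L. c l * f l u) \<noteq> 0 \<and> (\<Sum>l\<in>L. c l * f l x) \<noteq> 0"
proof -
  have single: "(\<Sum>l\<in>L. (if l = k then 1 else 0) * f l y) = f k y" if "k \<in> L" for k y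
    using that \<open>finite L\<close>
    by (simp add: if_distrib[of "\<lambda>c. c * _"] sum.delta cong: if_cong)
  consider "f i x \<noteq> 0" | "f j u \<noteq> 0" | "f i x = 0" "f j u = 0" by blast
  then show ?thesis
  proof cases
    case 1
    then show ?thesis
      using single assms by (intro exI[of _ "\<lambda>l. if l = i then 1 else 0"]) auto
  next
    case 2
    then show ?thesis
      using single assms by (intro exI[of _ "\<lambda>l. if l = j then 1 else 0"]) auto
  next
    case 3
    have "(\<Sum>l\<in>L. ((if l = i then 1 else 0) + (if l = j then 1 else 0)) * f l y) = f i y + f j y" for y
      using single assms by (simp only: distrib_right sum.distrib)
    then show ?thesis
      using 3 assms
      by (intro exI[of _ "\<lambda>l. (if l = i then 1 else 0) + (if l = j then 1 else 0)"]) auto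
  qed
qed

text \<open>
  The data \<open>x\<close>, \<open>\<phi>\<close> for one step: the operator \<open>z \<mapsto> T z + (x - T x) \<phi>(z)\<close> fixes \<open>x\<close> in addition
  to the common kernel of the \<open>f l\<close> and remains singular. If the image of \<open>T\<close> is not contained
  in that kernel, \<open>x\<close> is taken from the image; otherwise \<open>p\<close> and \<open>f\<close> are dual bases.
\<close>

lemma fix_one_more:
  fixes p :: "'i \<Rightarrow> 'v"
  assumes "finite L" and f: "\<And>l. l \<in> L \<Longrightarrow> functional (f l)"
    and indep: "\<And>c. (\<And>x. (\<Sum>l\<in>L. c l * f l x) = 0) \<Longrightarrow> \<forall>l\<in>L. c l = 0"
    and card: "card L \<ge> 2"
    and u: "id_minus L p f u = 0" "u \<noteq> 0"
  obtains c x v where "(\<Sum>l\<in>L. c l * f l u) = 1" "(\<Sum>l\<in>L. c l * f l x) = 1" "v \<noteq> 0"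
    "id_minus L p f v + (\<Sum>l\<in>L. p l \<cdot> f l x) \<cdot> (\<Sum>l\<in>L. c l * f l v) = 0"
proof -
  let ?T = "id_minus L p f"
  have u_eq: "u = (\<Sum>l\<in>L. p l \<cdot> f l u)"
    using u(1) by (simp add: id_minus_def)
  obtain i where i: "i \<in> L" "f i u \<noteq> 0"
  proof -
    have "\<exists>i\<in>L. f i u \<noteq> 0"
    proof (rule ccontr)
      assume "\<not> ?thesis"
      then have "(\<Sum>l\<in>L. p l \<cdot> f l u) = 0" by (intro sum.neutral) simp
      with u_eq u(2) show False by simp
    qed
    with that show thesis by blast
  qed
  show ?thesis
  proof (cases "\<exists>y. \<exists>j\<in>L. f j (?T y) \<noteq> 0")
    case True
    then obtain y j where j: "j \<in> L" "f j (?T y) \<noteq> 0" by blast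
    obtain c where c: "(\<Sum>l\<in>L. c l * f l u) \<noteq> 0" "(\<Sum>l\<in>L. c l * f l (?T y)) \<noteq> 0"
      using common_nonvanishing[of L i f u j "?T y"] \<open>finite L\<close> i j by blast
    \<comment> \<open>Scaling the coefficients on the left normalises \<open>\<phi>\<close> at
      \<open>u\<close>. Scaling \<open>y\<close> on the right then gives \<open>\<phi> x = 1\<close>
      while \<open>x\<close> stays in the image of \<open>?T\<close>.\<close>
    define d where "d l = inverse (\<Sum>l\<in>L. c l * f l u) * c l" for l
    define \<phi> where "\<phi> z = (\<Sum>l\<in>L. d l * f l z)" for z
    have \<phi>: "functional \<phi>"
      unfolding \<phi>_def using f by (rule functional_lincomb)
    have \<phi>_eq: "\<phi> z = inverse (\<Sum>l\<in>L. c l * f l u) * (\<Sum>l\<in>L. c l * f l z)" for z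
      by (simp add: \<phi>_def d_def sum_distrib_left mult.assoc)
    have \<phi>u: "\<phi> u = 1" and \<phi>y: "\<phi> (?T y) \<noteq> 0"
      using c by (simp_all add: \<phi>_eq)
    define y' where "y' = y \<cdot> inverse (\<phi> (?T y))"
    define x where "x = ?T y'"
    have x: "\<phi> x = 1"
      using \<phi>y f by (simp add: x_def y'_def id_minus_smul functional_smul[OF \<phi>])
    \<comment> \<open>The left side is \<open>x - ?T x\<close>. Since \<open>x = ?T y'\<close>, it
      lies in the image of \<open>?T\<close>, which is the form \<open>perturbation_singular\<close>
      asks for, with \<open>z = y' - x\<close>.\<close>
    have w: "(\<Sum>l\<in>L. p l \<cdot> f l x) = ?T (y' - x)"
      using f by (simp add: id_minus_diff flip: x_def) (simp add: id_minus_def)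
    obtain v where "v \<noteq> 0" "?T v + ?T (y' - x) \<cdot> \<phi> v = 0"
      using perturbation_singular[of ?T \<phi> u] f \<phi> \<phi>u u(1) by (metis id_minus_add id_minus_smul)
    then show ?thesis
      using that[of d x v] \<phi>u x w by (simp add: \<phi>_def)
  next
    case False
    \<comment> \<open>As \<open>f k\<close> vanishes on the image of \<open>?T\<close>, it equals
      the combination of the \<open>f l\<close> with coefficients \<open>f k (p l)\<close>.
      Independence identifies these coefficients with Kronecker deltas.\<close>
    have dual: "\<forall>l\<in>L. f k (p l) - (if l = k then 1 else 0) = 0" if k: "k \<in> L" for k
    proof (rule indep)
      fix x
      have "f k (?T x) = 0" using False k by blast
      then have "(\<Sum>l\<in>L. f k (p l) * f l x) = f k x"
        by (simp add: id_minus_def functional_diff functional_sum functional_smul f k)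
      then show "(\<Sum>l\<in>L. (f k (p l) - (if l = k then 1 else 0)) * f l x) = 0"
        using k \<open>finite L\<close>
        by (simp add: left_diff_distrib sum_subtractf if_distrib[of "\<lambda>c. c * _"] sum.delta cong: if_cong)
    qed
    have "\<not> L \<subseteq> {i}"
      using card card_mono[of "{i}" L] by auto
    then obtain j where j: "j \<in> L" "j \<noteq> i" by blast
    have "?T (p j) = p j - (\<Sum>l\<in>L. if l = j then p l else 0)"
      unfolding id_minus_def using dual j
      by (intro arg_cong2[where f = minus] refl sum.cong) (auto simp: smul_one)
    then have Tp: "?T (p j) = 0"
      using j \<open>finite L\<close> by (simp add: sum.delta)
    have fp: "f j (p j) = 1" "f i (p j) = 0"
      using dual[OF j(1)] dual[OF i(1)] j by auto
    \<comment> \<open>This makes \<open>\<phi>\<close> the multiple of \<open>f i\<close> with value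
      1 at \<open>u\<close>, and \<open>x = u\<close> is used. Both \<open>?T\<close> and
      \<open>\<phi>\<close> vanish at \<open>p j\<close>, so \<open>p j\<close> stays in the kernel
      after the perturbation.\<close>
    define c where "c l = (if l = i then inverse (f i u) else 0)" for l
    have c: "(\<Sum>l\<in>L. c l * f l z) = inverse (f i u) * f i z" for z
      using i \<open>finite L\<close> by (simp add: c_def if_distrib[of "\<lambda>c. c * _"] sum.delta cong: if_cong)
    have "p j \<noteq> 0"
      using fp functional_zero[OF f[OF j(1)]] by auto
    then show ?thesis
      using that[of c u "p j"] i Tp fp by (simp add: c)
  qed
qed

text \<open>The subspace \<open>W\<close> confines the vectors of the factors. Taking the sequences
  supported below \<open>n\<close> for \<open>W\<close> lets the factors be read as
  \<open>n\<close>-by-\<open>n\<close> matrices.\<close>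

theorem singular_product_of_corank_one_idem:
  fixes p :: "'i \<Rightarrow> 'v"
  assumes "finite L" and "\<And>l. l \<in> L \<Longrightarrow> functional (f l)"
    and "subspace W" and "\<And>l. l \<in> L \<Longrightarrow> p l \<in> W"
    and "id_minus L p f u = 0" and "u \<noteq> 0"
  shows "\<exists>es. length es \<le> card L \<and>
     (\<forall>(v, \<phi>) \<in> set es. v \<in> W \<and> functional \<phi> \<and> \<phi> v = 1) \<and>
     id_minus L p f = foldr (\<lambda>e g. corank_one_idem e \<circ> g) es id"
  using assms
proof (induction "card L" arbitrary: L p f u rule: less_induct)
  case less
  note W = less.prems(3) and f = less.prems(2) and p = less.prems(4) and u = less.prems(5,6)
    and fin = less.prems(1)
  let ?T = "id_minus L p f"
  \<comment> \<open>A dependence saves one term, and the induction hypothesis applies. The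
    functionals \<open>g\<close> are arbitrary because this serves both for dependent
    \<open>f\<close> and for the perturbed functionals below.\<close>
  have eliminate: "\<exists>es. length es \<le> card L - 1 \<and>
     (\<forall>(v, \<phi>) \<in> set es. v \<in> W \<and> functional \<phi> \<and> \<phi> v = 1) \<and>
     id_minus L p g = foldr (\<lambda>e g. corank_one_idem e \<circ> g) es id"
    if j: "j \<in> L" "c j \<noteq> 0" and dep: "\<And>x. (\<Sum>l\<in>L. c l * g l x) = 0"
      and g: "\<And>l. l \<in> L \<Longrightarrow> functional (g l)" and v: "id_minus L p g v = 0" "v \<noteq> 0"
    for c j g v
  proof -
    let ?q = "\<lambda>l. p l - p j \<cdot> (inverse (c j) * c l)"
    have eq: "id_minus L p g = id_minus (L - {j}) ?q g"
      using id_minus_eliminate[OF fin j dep] .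
    have cardj: "card (L - {j}) = card L - 1" "card (L - {j}) < card L"
      using j fin by (auto intro: card_Diff1_less simp del: card_Diff_insert card_Diff_singleton)
        (simp add: card_Diff_singleton)
    show ?thesis
      unfolding eq cardj(1)[symmetric]
      by (rule less.hyps[OF cardj(2)])
        (use fin g W p j v eq in \<open>auto intro!: subspace_diff subspace_smul\<close>)
  qed
  show ?case
  proof (cases "\<exists>c. (\<forall>x. (\<Sum>l\<in>L. c l * f l x) = 0) \<and> (\<exists>l\<in>L. c l \<noteq> 0)")
    case True
    then obtain c j where "j \<in> L" "c j \<noteq> 0" "\<And>x. (\<Sum>l\<in>L. c l * f l x) = 0" by blast
    from eliminate[OF this f u] show ?thesis
      by (meson diff_le_self order_trans)
  next
    case indep: False
    have u_eq: "u = (\<Sum>l\<in>L. p l \<cdot> f l u)"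
      using u(1) by (simp add: id_minus_def)
    have "L \<noteq> {}"
      using u_eq u(2) by auto
    then consider "card L = 1" | "card L \<ge> 2"
      using fin by (metis One_nat_def Suc_1 Suc_leI card_gt_0_iff le_neq_implies_less)
    then show ?thesis
    proof cases
      case 1
      then obtain i where L: "L = {i}"
        by (auto simp: card_1_singleton_iff)
      \<comment> \<open>With one term, the kernel vector is a multiple of \<open>p i\<close>.
        Applying \<open>f i\<close> and cancelling \<open>f i u\<close> gives
        \<open>f i (p i) = 1\<close>, so \<open>?T\<close> is itself one of the required
        factors.\<close>
      have ui: "u = p i \<cdot> f i u"
        using u_eq L by simp
      then have "f i u \<noteq> 0"
        using u(2) by (metis smul_zero_right)
      moreover have "f i u = f i (p i) * f i u"
        using ui functional_smul f L by (metis insertI1)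
      ultimately have "f i (p i) = 1"
        by (metis mult_cancel_right mult_1)
      then show ?thesis
        using p f L by (intro exI[of _ "[(p i, f i)]"])
          (auto simp: id_minus_def corank_one_idem_def fun_eq_iff)
    next
      case 2
      obtain c x v where c: "(\<Sum>l\<in>L. c l * f l u) = 1" "(\<Sum>l\<in>L. c l * f l x) = 1" "v \<noteq> 0"
        "?T v + (\<Sum>l\<in>L. p l \<cdot> f l x) \<cdot> (\<Sum>l\<in>L. c l * f l v) = 0"
        using fix_one_more[of L f p u thesis] fin f 2 u indep by blast
      define \<phi> where "\<phi> z = (\<Sum>l\<in>L. c l * f l z)" for z
      have \<phi>: "functional \<phi>"
        unfolding \<phi>_def using f by (rule functional_lincomb)
      \<comment> \<open>Adding \<open>(x - ?T x) \<phi>\<close> to \<open>?T\<close> keeps the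
        columns \<open>p l\<close> and only replaces the functionals, by ones that vanish at
        \<open>x\<close>.\<close>
      define g where "g l z = f l z - f l x * \<phi> z" for l z
      have T': "id_minus L p g z = ?T z + (\<Sum>l\<in>L. p l \<cdot> f l x) \<cdot> \<phi> z" for z
        by (simp add: id_minus_def g_def smul_diff_right smul_mult sum_subtractf smul_sum_left)
      have g: "functional (g l)" if "l \<in> L" for l
        unfolding g_def using f[OF that] \<phi> by (rule functional_combine)
      \<comment> \<open>The combination is \<open>\<phi> - \<phi>(x) \<phi>\<close>, and
        \<open>\<phi> x = 1\<close>.\<close>
      have dep: "(\<Sum>l\<in>L. c l * g l z) = 0" for z
        using c(2) by (simp add: g_def right_diff_distrib sum_subtractf \<phi>_def
            flip: mult.assoc sum_distrib_right)
      obtain j where j: "j \<in> L" "c j \<noteq> 0"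
        using c(1) by (metis (no_types, lifting) mult_zero_left sum.neutral zero_neq_one)
      obtain es where es: "length es \<le> card L - 1"
        "\<forall>(v, \<phi>) \<in> set es. v \<in> W \<and> functional \<phi> \<and> \<phi> v = 1"
        "id_minus L p g = foldr (\<lambda>e g. corank_one_idem e \<circ> g) es id"
        using eliminate[OF j dep g _ c(3)] c(4) T' by (auto simp: \<phi>_def)
      have snoc: "foldr (\<lambda>e g. corank_one_idem e \<circ> g) (ds @ [d]) id
          = foldr (\<lambda>e g. corank_one_idem e \<circ> g) ds id \<circ> corank_one_idem d" for ds d
        by (induction ds) auto
      \<comment> \<open>The factor \<open>1 - u \<phi>\<close> maps into the kernel of
        \<open>\<phi>\<close>, where the perturbed operator agrees with \<open>?T\<close>; moreover
        \<open>?T u = 0\<close>.\<close>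
      have "?T = id_minus L p g \<circ> corank_one_idem (u, \<phi>)"
      proof
        fix z
        have \<phi>u: "\<phi> u = 1" using c(1) by (simp add: \<phi>_def)
        show "?T z = (id_minus L p g \<circ> corank_one_idem (u, \<phi>)) z"
          using f u \<phi>u by (simp add: T' corank_one_idem_def id_minus_diff id_minus_smul
              functional_diff[OF \<phi>] functional_smul[OF \<phi>])
      qed
      then have "?T = foldr (\<lambda>e g. corank_one_idem e \<circ> g) (es @ [(u, \<phi>)]) id"
        using es(3) snoc by metis
      moreover have "u \<in> W"
        by (subst u_eq) (use W p in \<open>auto intro!: subspace_sum subspace_smul\<close>)
      moreover have "\<phi> u = 1" using c(1) by (simp add: \<phi>_def)
      ultimately show ?thesis
        using es(1,2) \<phi> 2 by (intro exI[of _ "es @ [(u, \<phi>)]"]) auto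
    qed
  qed
qed

end

section \<open>Homogeneous systems and rank\<close>

text \<open>Gaussian elimination: equation \<open>k\<close> is solved for an unknown
  \<open>l\<close> with nonzero coefficient and substituted into the others. Unknowns stand to the
  right of the coefficients throughout.\<close>

lemma homogeneous_system_nontrivial:
  fixes a :: "'i \<Rightarrow> 'j \<Rightarrow> 'a::division_ring"
  assumes "finite I" and "finite J" and "card I < card J"
  shows "\<exists>x. (\<exists>j\<in>J. x j \<noteq> 0) \<and> (\<forall>i\<in>I. (\<Sum>j\<in>J. a i j * x j) = 0)"
  using assms
proof (induction I arbitrary: a J rule: finite_induct)
  case empty
  then obtain j where "j \<in> J" by fastforce
  then show ?case by (intro exI[of _ "\<lambda>_. 1"]) auto
next
  case (insert k I)
  show ?case
  proof (cases "\<forall>j\<in>J. a k j = 0")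
    case True
    have "card I < card J" using insert by auto
    then show ?thesis
      using insert.IH[OF insert.prems(1), of a] True by auto
  next
    case False
    then obtain l where l: "l \<in> J" "a k l \<noteq> 0" by blast
    have "card I < card (J - {l})" using insert l by auto
    then obtain x where x: "\<exists>j\<in>J - {l}. x j \<noteq> 0"
      "\<forall>i\<in>I. (\<Sum>j\<in>J - {l}. (a i j - a i l * inverse (a k l) * a k j) * x j) = 0"
      using insert.IH[of "J - {l}" "\<lambda>i j. a i j - a i l * inverse (a k l) * a k j"] insert.prems
      by auto
    define s where "s = (\<Sum>j\<in>J - {l}. a k j * x j)"
    define y where "y = x(l := - inverse (a k l) * s)"
    have split: "(\<Sum>j\<in>J. a i j * y j) = - (a i l * inverse (a k l) * s) + (\<Sum>j\<in>J - {l}. a i j * x j)" for i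
      using l insert.prems(1) by (simp add: sum.remove[of J l] y_def mult.assoc)
    have "(\<Sum>j\<in>J. a k j * y j) = 0"
      unfolding split using l by (simp add: s_def)
    moreover have "(\<Sum>j\<in>J. a i j * y j) = 0" if "i \<in> I" for i
      unfolding split using x(2)[rule_format, OF that]
      by (simp add: s_def left_diff_distrib sum_subtractf sum_distrib_left mult.assoc)
    moreover have "\<exists>j\<in>J. y j \<noteq> 0"
      using x(1) by (auto simp: y_def)
    ultimately show ?thesis by blast
  qed
qed

section \<open>Independent sets and dimension over a skew field\<close>

lemma right_independent_card_le:
  assumes "finite B" and "finite C" and "right_independent n B" and "B \<subseteq> right_span n C"
  shows "card B \<le> card C"
proof (rule ccontr)
  assume "\<not> card B \<le> card C"
  have "\<forall>b\<in>B. \<exists>c. b = right_lincomb n c C"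
    using assms(4) by (auto simp: right_span_def)
  then obtain a where a: "\<And>b. b \<in> B \<Longrightarrow> b = right_lincomb n (a b) C" by metis
  \<comment> \<open>The coordinates of the vectors of \<open>B\<close> with respect to
    \<open>C\<close> form a system with more unknowns than equations; a nontrivial solution is a
    linear relation on \<open>B\<close>.\<close>
  obtain x where x: "\<exists>b\<in>B. x b \<noteq> 0" "\<forall>c\<in>C. (\<Sum>b\<in>B. a b c * x b) = 0"
    using homogeneous_system_nontrivial[OF assms(2,1), of "\<lambda>c b. a b c"] \<open>\<not> _\<close> by auto
  have "(\<Sum>b\<in>B. b $ i * x b) = 0" if "i < n" for i
  proof -
    have "b $ i = (\<Sum>v\<in>C. v $ i * a b v)" if "b \<in> B" for b
      using arg_cong[OF a[OF that], of "\<lambda>v. v $ i"] \<open>i < n\<close> by (simp add: right_lincomb_def)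
    then have "(\<Sum>b\<in>B. b $ i * x b) = (\<Sum>b\<in>B. \<Sum>v\<in>C. v $ i * (a b v * x b))"
      by (simp add: sum_distrib_right mult.assoc)
    also have "\<dots> = (\<Sum>v\<in>C. v $ i * (\<Sum>b\<in>B. a b v * x b))"
      by (subst sum.swap) (simp add: sum_distrib_left)
    finally show ?thesis using x(2) by simp
  qed
  then have "right_lincomb n x B = 0\<^sub>v n"
    by (auto simp: right_lincomb_def)
  with x(1) assms(3) show False
    by (auto simp: right_independent_def)
qed

lemma subset_right_span:
  assumes "finite B" and "B \<subseteq> carrier_vec n"
  shows "B \<subseteq> right_span n B"
proof
  fix b assume b: "b \<in> B"
  have "right_lincomb n (\<lambda>v. if v = b then 1 else 0) B = b"
  proof
    fix i assume "i < dim_vec b"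
    then show "right_lincomb n (\<lambda>v. if v = b then 1 else 0) B $ i = b $ i"
      using b assms
      by (auto simp: right_lincomb_def if_distrib[of "\<lambda>c. _ * c"] sum.delta' cong: if_cong)
  qed (use b assms in \<open>auto simp: right_lincomb_def\<close>)
  then show "b \<in> right_span n B"
    by (metis (mono_tags, lifting) CollectI right_span_def)
qed

text \<open>Two bases span each other, so the comparison of cardinalities applies both ways and the
  choice made by \<open>SOME\<close> does not matter.\<close>

lemma right_dim_eq_card:
  assumes "right_basis n V B"
  shows "right_dim n V = card B"
proof -
  define C where "C = (SOME B. right_basis n V B)"
  have C: "right_basis n V C"
    unfolding C_def using assms by (rule someI)
  then have "card B = card C"
    using assms subset_right_span[of B n] subset_right_span[of C n]
    by (intro antisym right_independent_card_le) (auto simp: right_basis_def)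
  then show ?thesis
    by (simp add: right_dim_def C_def)
qed

lemma right_dim_hyperplane:
  fixes f :: "nat \<Rightarrow> 'a::division_ring"
  assumes "l < n" and "f l \<noteq> 0"
  shows "right_dim n {x \<in> carrier_vec n. (\<Sum>j<n. f j * x $ j) = 0} = n - 1"
proof -
  define J where "J = {..<n} - {l}"
  \<comment> \<open>For \<open>j \<noteq> l\<close> this is the unit vector at \<open>j\<close>,
    corrected in coordinate \<open>l\<close> so that it lies in the hyperplane.\<close>
  define b where "b j = vec n (\<lambda>i. (if i = j then 1 else 0) - (if i = l then inverse (f l) * f j else 0))"
    for j
  have b_inj: "inj_on b J"
  proof
    fix i j assume ij: "i \<in> J" "j \<in> J" "b i = b j"
    then have "b i $ i = b j $ i" by simp
    with ij(1,2) show "i = j" by (simp add: b_def J_def split: if_splits)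
  qed
  \<comment> \<open>Away from \<open>l\<close>, the coordinates of a combination are its
    coefficients, which yields independence. Coordinate \<open>l\<close> is the one that the
    equation of the hyperplane dictates, which yields the span.\<close>
  have comb: "right_lincomb n c (b ` J) $ i =
      (if i = l then - (inverse (f l) * (\<Sum>j\<in>J. f j * c (b j))) else c (b i))" if "i < n" for c i
  proof -
    have "right_lincomb n c (b ` J) $ i = (\<Sum>j\<in>J. b j $ i * c (b j))"
      using that by (simp add: right_lincomb_def sum.reindex[OF b_inj])
    also have "\<dots> = (if i = l then - (inverse (f l) * (\<Sum>j\<in>J. f j * c (b j))) else c (b i))"
    proof (cases "i = l")
      case True
      then have "(\<Sum>j\<in>J. b j $ i * c (b j)) = (\<Sum>j\<in>J. - (inverse (f l) * (f j * c (b j))))"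
        using that by (intro sum.cong) (auto simp: b_def J_def mult.assoc)
      then show ?thesis
        using True by (simp add: sum_negf sum_distrib_left)
    next
      case False
      then have "(\<Sum>j\<in>J. b j $ i * c (b j)) = (\<Sum>j\<in>J. if i = j then c (b j) else 0)"
        using that by (intro sum.cong) (auto simp: b_def)
      then show ?thesis
        using False that by (simp add: J_def sum.delta')
    qed
    finally show ?thesis .
  qed
  have sumJ: "(\<Sum>j<n. g j) = g l + (\<Sum>j\<in>J. g j)" for g :: "nat \<Rightarrow> 'a"
    using \<open>l < n\<close> by (simp add: J_def sum.remove)
  have "right_basis n {x \<in> carrier_vec n. (\<Sum>j<n. f j * x $ j) = 0} (b ` J)"
    unfolding right_basis_def
  proof (intro conjI)
    show "finite (b ` J)" by (simp add: J_def)
    show "b ` J \<subseteq> carrier_vec n" by (auto simp: b_def)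
    show "right_independent n (b ` J)"
      unfolding right_independent_def
    proof (intro allI impI ballI)
      fix c v assume c: "right_lincomb n c (b ` J) = 0\<^sub>v n" and "v \<in> b ` J"
      then obtain j where j: "j \<in> J" "v = b j" by blast
      then show "c v = 0"
        using comb[of j c] c by (auto simp: J_def)
    qed
    show "right_span n (b ` J) = {x \<in> carrier_vec n. (\<Sum>j<n. f j * x $ j) = 0}"
    proof (intro equalityI subsetI)
      fix x assume "x \<in> right_span n (b ` J)"
      then obtain c where c: "x = right_lincomb n c (b ` J)"
        by (auto simp: right_span_def)
      have "x $ j = c (b j)" if "j \<in> J" for j
        using comb[of j c] that by (auto simp: c J_def)
      then have "(\<Sum>j\<in>J. f j * x $ j) = (\<Sum>j\<in>J. f j * c (b j))" by simp
      then have "(\<Sum>j<n. f j * x $ j) = 0"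
        using assms by (simp add: sumJ) (simp add: c comb flip: mult.assoc)
      then show "x \<in> {x \<in> carrier_vec n. (\<Sum>j<n. f j * x $ j) = 0}"
        by (simp add: c right_lincomb_def)
    next
      fix x assume "x \<in> {x \<in> carrier_vec n. (\<Sum>j<n. f j * x $ j) = 0}"
      then have x: "x \<in> carrier_vec n" "f l * x $ l + (\<Sum>j\<in>J. f j * x $ j) = 0"
        by (auto simp: sumJ)
      \<comment> \<open>Coefficients are indexed by basis vectors, hence the passage back to indices
        through the inverse of \<open>b\<close>.\<close>
      define c where "c v = x $ (the_inv_into J b v)" for v
      have c: "c (b j) = x $ j" if "j \<in> J" for j
        using that b_inj by (simp add: c_def the_inv_into_f_f)
      have "(\<Sum>j\<in>J. f j * x $ j) = - (f l * x $ l)"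
        using x(2) by (simp add: eq_neg_iff_add_eq_0 add.commute)
      then have xl: "- (inverse (f l) * (\<Sum>j\<in>J. f j * x $ j)) = x $ l"
        using assms by (simp flip: mult.assoc)
      have "right_lincomb n c (b ` J) = x"
      proof
        fix i assume "i < dim_vec x"
        then have "i < n" using x by auto
        then show "right_lincomb n c (b ` J) $ i = x $ i"
          using c xl by (cases "i = l") (auto simp: comb, auto simp: J_def)
      qed (use x in \<open>auto simp: right_lincomb_def\<close>)
      then show "x \<in> right_span n (b ` J)"
        by (auto simp: right_span_def)
    qed
  qed
  then have "right_dim n {x \<in> carrier_vec n. (\<Sum>j<n. f j * x $ j) = 0} = card (b ` J)"
    by (rule right_dim_eq_card)
  then show ?thesis
    using card_image[OF b_inj] \<open>l < n\<close> by (simp add: J_def)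
qed

section \<open>Column spaces and the rank of the identity minus a rank-one matrix\<close>

lemma right_span_set_cols:
  fixes E :: "'a::division_ring mat"
  assumes E: "E \<in> carrier_mat n m"
  shows "right_span n (set (cols E)) = {vec n (\<lambda>i. \<Sum>j<m. E $$ (i, j) * c j) | c. True}"
proof -
  have cols: "set (cols E) = col E ` {..<m}"
    using E by (auto simp: cols_def)
  show ?thesis
  proof (intro equalityI subsetI)
    fix x assume "x \<in> right_span n (set (cols E))"
    then obtain c where x: "x = right_lincomb n c (set (cols E))"
      by (auto simp: right_span_def)
    txt \<open>Columns may coincide, so a coefficient is given to one representative index only.\<close>
    define r where "r = inv_into {..<m} (col E)"
    have r: "r v < m \<and> col E (r v) = v" if "v \<in> col E ` {..<m}" for v
      using inv_into_into[OF that] f_inv_into_f[OF that] by (auto simp: r_def)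
    let ?C = "col E ` {..<m}"
    have r_inj: "inj_on r ?C"
      unfolding r_def by (rule inj_on_inv_into) simp
    have "x = vec n (\<lambda>i. \<Sum>j<m. E $$ (i, j) * (if j \<in> r ` ?C then c (col E j) else 0))"
    proof (unfold x right_lincomb_def cols, intro eq_vecI)
      fix i assume i: "i < dim_vec (vec n (\<lambda>i. \<Sum>j<m. E $$ (i, j) * (if j \<in> r ` ?C then c (col E j) else 0)))"
      have "(\<Sum>j<m. E $$ (i, j) * (if j \<in> r ` ?C then c (col E j) else 0))
          = (\<Sum>j\<in>r ` ?C. E $$ (i, j) * c (col E j))"
        using r by (intro sum.mono_neutral_cong_right) auto
      also have "\<dots> = (\<Sum>v\<in>?C. E $$ (i, r v) * c (col E (r v)))"
        by (simp add: sum.reindex[OF r_inj])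
      also have "\<dots> = (\<Sum>v\<in>?C. v $ i * c v)"
      proof (intro sum.cong refl)
        fix v assume v: "v \<in> ?C"
        have "col E (r v) $ i = E $$ (i, r v)"
          using r[OF v, THEN conjunct1] i E by (intro index_col) auto
        then show "E $$ (i, r v) * c (col E (r v)) = v $ i * c v"
          using r[OF v] by simp
      qed
      finally show "vec n (\<lambda>i. \<Sum>v\<in>?C. v $ i * c v) $ i
        = vec n (\<lambda>i. \<Sum>j<m. E $$ (i, j) * (if j \<in> r ` ?C then c (col E j) else 0)) $ i"
        using i by simp
    qed auto
    then show "x \<in> {vec n (\<lambda>i. \<Sum>j<m. E $$ (i, j) * c j) | c. True}"
      by (intro CollectI exI[of _ "\<lambda>j. if j \<in> r ` ?C then c (col E j) else 0"]) simp
  next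
    fix x assume "x \<in> {vec n (\<lambda>i. \<Sum>j<m. E $$ (i, j) * c j) | c. True}"
    then obtain c where x: "x = vec n (\<lambda>i. \<Sum>j<m. E $$ (i, j) * c j)" by blast
    \<comment> \<open>Equal columns are a single element of the set, so their coefficients are added
      up.\<close>
    define d where "d v = (\<Sum>j | j \<in> {..<m} \<and> col E j = v. c j)" for v
    have "x = right_lincomb n d (set (cols E))"
    proof (unfold x right_lincomb_def cols, intro eq_vecI)
      fix i assume i: "i < dim_vec (vec n (\<lambda>i. \<Sum>v\<in>col E ` {..<m}. v $ i * d v))"
      have "(\<Sum>j<m. E $$ (i, j) * c j)
          = (\<Sum>v\<in>col E ` {..<m}. \<Sum>j | j \<in> {..<m} \<and> col E j = v. E $$ (i, j) * c j)"
        by (rule sum.image_gen) simp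
      also have "\<dots> = (\<Sum>v\<in>col E ` {..<m}. v $ i * d v)"
        unfolding d_def sum_distrib_left using i E by (intro sum.cong) auto
      finally show "vec n (\<lambda>i. \<Sum>j<m. E $$ (i, j) * c j) $ i
          = vec n (\<lambda>i. \<Sum>v\<in>col E ` {..<m}. v $ i * d v) $ i"
        using i by simp
    qed auto
    then show "x \<in> right_span n (set (cols E))"
      by (auto simp: right_span_def)
  qed
qed

text \<open>The column space is the hyperplane on which \<open>f\<close> vanishes:
  \<open>f v = 1\<close> gives \<open>f (1 - v f) = 0\<close>, and every vector killed by
  \<open>f\<close> is fixed.\<close>

lemma mat_rank_id_minus_rank_one:
  fixes v f :: "nat \<Rightarrow> 'a::division_ring"
  assumes fv: "(\<Sum>i<n. f i * v i) = 1"
  shows "mat_rank (mat n n (\<lambda>(i, j). (if i = j then 1 else 0) - v i * f j)) = n - 1"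
proof -
  let ?E = "mat n n (\<lambda>(i, j). (if i = j then 1 else 0) - v i * f j)"
  obtain l where l: "l < n" "f l \<noteq> 0"
    using fv by (metis (no_types, lifting) lessThan_iff mult_zero_left sum.neutral zero_neq_one)
  have app: "(\<Sum>j<n. ?E $$ (i, j) * c j) = c i - v i * (\<Sum>j<n. f j * c j)" if "i < n" for i c
  proof -
    have "(\<Sum>j<n. ?E $$ (i, j) * c j) = (\<Sum>j<n. (if i = j then c j else 0) - v i * (f j * c j))"
      using that by (intro sum.cong) (auto simp: left_diff_distrib mult.assoc)
    then show ?thesis
      using that by (simp add: sum_subtractf sum_distrib_left)
  qed
  have "right_span n (set (cols ?E)) = {x \<in> carrier_vec n. (\<Sum>j<n. f j * x $ j) = 0}"
    unfolding right_span_set_cols[of ?E n n, OF mat_carrier]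
  proof (intro equalityI subsetI)
    fix x assume "x \<in> {vec n (\<lambda>i. \<Sum>j<n. ?E $$ (i, j) * c j) | c. True}"
    then obtain c where x: "x = vec n (\<lambda>i. \<Sum>j<n. ?E $$ (i, j) * c j)" by blast
    have "(\<Sum>i<n. f i * x $ i) = (\<Sum>i<n. f i * c i - f i * v i * (\<Sum>j<n. f j * c j))"
      by (intro sum.cong) (auto simp: x app right_diff_distrib mult.assoc simp del: index_mat)
    also have "\<dots> = 0"
      by (simp add: sum_subtractf fv flip: sum_distrib_right)
    finally show "x \<in> {x \<in> carrier_vec n. (\<Sum>j<n. f j * x $ j) = 0}"
      by (simp add: x)
  next
    fix x assume "x \<in> {x \<in> carrier_vec n. (\<Sum>j<n. f j * x $ j) = 0}"
    then have "x = vec n (\<lambda>i. \<Sum>j<n. ?E $$ (i, j) * x $ j)"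
      by (intro eq_vecI) (auto simp: app simp del: index_mat)
    then show "x \<in> {vec n (\<lambda>i. \<Sum>j<n. ?E $$ (i, j) * c j) | c. True}" by blast
  qed
  then show ?thesis
    using right_dim_hyperplane[of l n f, OF l] by (simp add: mat_rank_def)
qed

section \<open>Kernel vectors of singular matrices, for zero divisors on either side\<close>

lemma singular_mat_kernel:
  fixes A :: "'a::division_ring mat"
  assumes "singular_mat n A"
  shows "\<exists>x. (\<exists>j<n. x j \<noteq> 0) \<and> (\<forall>i<n. (\<Sum>j<n. A $$ (i, j) * x j) = 0)"
proof -
  obtain B where A: "A \<in> carrier_mat n n" and B: "B \<in> carrier_mat n n" "B \<noteq> 0\<^sub>m n n"
    and AB: "A * B = 0\<^sub>m n n \<or> B * A = 0\<^sub>m n n"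
    using assms by (auto simp: singular_mat_def zero_divisor_def ring_mat_def)
  obtain k l where kl: "k < n" "l < n" "B $$ (k, l) \<noteq> 0"
    using B by (metis carrier_matD(1) carrier_matD(2) eq_matI index_zero_mat(1) index_zero_mat(2) index_zero_mat(3))
  have prod: "(X * Y) $$ (i, j) = (\<Sum>m<n. X $$ (i, m) * Y $$ (m, j))"
    if "X \<in> carrier_mat n n" "Y \<in> carrier_mat n n" "i < n" "j < n" for X Y :: "'a mat" and i j
    using that by (auto simp: scalar_prod_def atLeast0LessThan)
  from AB show ?thesis
  proof
    assume "A * B = 0\<^sub>m n n"
    then have "(\<Sum>m<n. A $$ (i, m) * B $$ (m, l)) = 0" if "i < n" for i
      using prod[OF A B(1) that kl(2)] that kl by simp
    then show ?thesis
      using kl by (intro exI[of _ "\<lambda>m. B $$ (m, l)"]) auto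
  next
    assume BA: "B * A = 0\<^sub>m n n"
    have rows: "B $$ (k, l) * A $$ (l, j) + (\<Sum>m\<in>{..<n} - {l}. B $$ (k, m) * A $$ (m, j)) = 0"
      if "j < n" for j
      using prod[OF B(1) A kl(1) that] BA that kl by (simp add: sum.remove[of _ l])
    \<comment> \<open>Row \<open>k\<close> of \<open>B\<close> is a linear relation between the rows
      of \<open>A\<close> with nonzero coefficient at row \<open>l\<close>. Without row
      \<open>l\<close>, there are \<open>n - 1\<close> equations in \<open>n\<close>
      unknowns.\<close>
    obtain x where x: "\<exists>j\<in>{..<n}. x j \<noteq> 0"
      "\<forall>i\<in>{..<n} - {l}. (\<Sum>j<n. A $$ (i, j) * x j) = 0"
      using homogeneous_system_nontrivial[of "{..<n} - {l}" "{..<n}" "\<lambda>i j. A $$ (i, j)"] kl by auto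
    \<comment> \<open>The relation between the rows, multiplied by \<open>x\<close> on the right,
      shows that \<open>x\<close> also solves the omitted equation \<open>l\<close>.\<close>
    have "0 = (\<Sum>j<n. (B $$ (k, l) * A $$ (l, j) + (\<Sum>m\<in>{..<n} - {l}. B $$ (k, m) * A $$ (m, j))) * x j)"
      using rows by simp
    also have "\<dots> = B $$ (k, l) * (\<Sum>j<n. A $$ (l, j) * x j) +
        (\<Sum>j<n. \<Sum>m\<in>{..<n} - {l}. B $$ (k, m) * (A $$ (m, j) * x j))"
      by (simp add: distrib_right sum.distrib sum_distrib_left sum_distrib_right mult.assoc)
    also have "(\<Sum>j<n. \<Sum>m\<in>{..<n} - {l}. B $$ (k, m) * (A $$ (m, j) * x j)) = 0"
      by (subst sum.swap) (use x(2) in \<open>simp flip: sum_distrib_left\<close>)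
    finally have "(\<Sum>j<n. A $$ (l, j) * x j) = 0"
      using kl by simp
    then show ?thesis
      using x by (intro exI[of _ x]) (metis DiffI lessThan_iff singletonD)
  qed
qed

section \<open>Matrices as operators on sequences\<close>

text \<open>The locale needs vectors that fill a type, so columns of length \<open>n\<close> are
  modelled as sequences that vanish from index \<open>n\<close> on.\<close>

definition seq_smul :: "(nat \<Rightarrow> 'a::division_ring) \<Rightarrow> 'a \<Rightarrow> nat \<Rightarrow> 'a" where
  "seq_smul x c = (\<lambda>i. x i * c)"

interpretation seq: right_space "seq_smul :: (nat \<Rightarrow> 'a::division_ring) \<Rightarrow> 'a \<Rightarrow> nat \<Rightarrow> 'a"
  by unfold_locales (auto simp: seq_smul_def fun_eq_iff algebra_simps)

definition supported_below :: "nat \<Rightarrow> (nat \<Rightarrow> 'a::zero) set" where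
  "supported_below n = {x. \<forall>i\<ge>n. x i = 0}"

definition unit_seq :: "nat \<Rightarrow> nat \<Rightarrow> 'a::zero_neq_one" where
  "unit_seq j = (\<lambda>i. if i = j then 1 else 0)"

definition mat_of_op :: "nat \<Rightarrow> ((nat \<Rightarrow> 'a) \<Rightarrow> nat \<Rightarrow> 'a::division_ring) \<Rightarrow> 'a mat" where
  "mat_of_op n g = mat n n (\<lambda>(i, j). g (unit_seq j) i)"

lemma subspace_supported_below: "seq.subspace (supported_below n)"
  by (auto simp: seq.subspace_def supported_below_def seq_smul_def)

lemma unit_seq_supported_below: "j < n \<Longrightarrow> unit_seq j \<in> supported_below n"
  by (auto simp: unit_seq_def supported_below_def)

lemma sum_fun_apply: "(\<Sum>l\<in>L. g l) i = (\<Sum>l\<in>L. g l i)"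
  by (induction L rule: infinite_finite_induct) auto

lemma functional_coordinate: "seq.functional (\<lambda>y. y l)"
  by (simp add: seq.functional_def seq_smul_def)

lemma functional_supported_below:
  assumes "seq.functional \<phi>" and "x \<in> supported_below n"
  shows "\<phi> x = (\<Sum>k<n. \<phi> (unit_seq k) * x k)"
proof -
  have "x = (\<Sum>k<n. seq_smul (unit_seq k) (x k))"
  proof
    fix i
    have "(\<Sum>k<n. seq_smul (unit_seq k) (x k)) i = (\<Sum>k<n. if i = k then x k else 0)"
      unfolding sum_fun_apply by (intro sum.cong) (auto simp: seq_smul_def unit_seq_def)
    also have "\<dots> = x i"
      using assms(2) by (auto simp: supported_below_def)
    finally show "x i = (\<Sum>k<n. seq_smul (unit_seq k) (x k)) i" by simp
  qed
  then have "\<phi> x = \<phi> (\<Sum>k<n. seq_smul (unit_seq k) (x k))" by simp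
  then show ?thesis
    by (simp add: seq.functional_sum[OF assms(1)] seq.functional_smul[OF assms(1)])
qed

lemma mat_of_op_corank_one_idem:
  "mat_of_op n (seq.corank_one_idem (v, \<phi>))
    = mat n n (\<lambda>(i, j). (if i = j then 1 else 0) - v i * \<phi> (unit_seq j))"
  by (auto simp: mat_of_op_def seq.corank_one_idem_def seq_smul_def unit_seq_def)

text \<open>Truncation to \<open>n\<close> coordinates is multiplicative here because
  \<open>h\<close> sends unit sequences to sequences supported below \<open>n\<close>, where
  \<open>\<phi>\<close> is determined by its values at the first \<open>n\<close> unit
  sequences.\<close>

lemma mat_of_op_comp:
  assumes \<phi>: "seq.functional \<phi>" and h: "\<And>x. x \<in> supported_below n \<Longrightarrow> h x \<in> supported_below n"
  shows "mat_of_op n (seq.corank_one_idem (v, \<phi>) \<circ> h)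
    = mat_of_op n (seq.corank_one_idem (v, \<phi>)) * mat_of_op n h"
proof (rule eq_matI)
  fix i j
  assume "i < dim_row (mat_of_op n (seq.corank_one_idem (v, \<phi>)) * mat_of_op n h)"
    and "j < dim_col (mat_of_op n (seq.corank_one_idem (v, \<phi>)) * mat_of_op n h)"
  then have ij: "i < n" "j < n" by (auto simp: mat_of_op_def)
  define y where "y = h (unit_seq j)"
  have y: "y \<in> supported_below n"
    using h unit_seq_supported_below ij by (auto simp: y_def)
  have "(mat_of_op n (seq.corank_one_idem (v, \<phi>)) * mat_of_op n h) $$ (i, j)
      = (\<Sum>k<n. (if i = k then y k else 0) - v i * (\<phi> (unit_seq k) * y k))"
    using ij unfolding mat_of_op_corank_one_idem
    by (auto simp: scalar_prod_def mat_of_op_def y_def left_diff_distrib mult.assoc atLeast0LessThan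
        intro!: sum.cong)
  also have "\<dots> = y i - v i * \<phi> y"
    using ij by (simp add: sum_subtractf functional_supported_below[OF \<phi> y] sum_distrib_left)
  finally show "mat_of_op n (seq.corank_one_idem (v, \<phi>) \<circ> h) $$ (i, j)
      = (mat_of_op n (seq.corank_one_idem (v, \<phi>)) * mat_of_op n h) $$ (i, j)"
    using ij by (simp add: mat_of_op_def seq.corank_one_idem_def seq_smul_def y_def)
qed (auto simp: mat_of_op_def)

lemma corank_one_idem_supported_below:
  "v \<in> supported_below n \<Longrightarrow> x \<in> supported_below n \<Longrightarrow> seq.corank_one_idem (v, \<phi>) x \<in> supported_below n"
  by (auto simp: seq.corank_one_idem_def supported_below_def seq_smul_def)

lemma mat_of_op_foldr:
  assumes "\<forall>(v, \<phi>) \<in> set es. v \<in> supported_below n \<and> seq.functional \<phi>"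
  shows "mat_of_op n (foldr (\<lambda>e g. seq.corank_one_idem e \<circ> g) es id)
    = foldr (*) (map (\<lambda>e. mat_of_op n (seq.corank_one_idem e)) es) (1\<^sub>m n)"
proof -
  \<comment> \<open>The claim is strengthened by invariance of the supported sequences, which
    \<open>mat_of_op_comp\<close> requires of the inner operator.\<close>
  have "(\<forall>x\<in>supported_below n. foldr (\<lambda>e g. seq.corank_one_idem e \<circ> g) es id x \<in> supported_below n)
    \<and> ?thesis"
    using assms
  proof (induction es)
    case Nil
    show ?case by (auto simp: mat_of_op_def unit_seq_def)
  next
    case (Cons e es)
    obtain v \<phi> where e: "e = (v, \<phi>)" by (cases e)
    let ?h = "foldr (\<lambda>e g. seq.corank_one_idem e \<circ> g) es id"
    have v: "v \<in> supported_below n" "seq.functional \<phi>"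
      using Cons.prems e by auto
    have "(\<forall>x\<in>supported_below n. ?h x \<in> supported_below n) \<and>
        mat_of_op n ?h = foldr (*) (map (\<lambda>e. mat_of_op n (seq.corank_one_idem e)) es) (1\<^sub>m n)"
      by (rule Cons.IH) (use Cons.prems in auto)
    then have h: "\<And>x. x \<in> supported_below n \<Longrightarrow> ?h x \<in> supported_below n"
      "mat_of_op n ?h = foldr (*) (map (\<lambda>e. mat_of_op n (seq.corank_one_idem e)) es) (1\<^sub>m n)"
      by blast+
    have "mat_of_op n (seq.corank_one_idem e \<circ> ?h) = mat_of_op n (seq.corank_one_idem e) * mat_of_op n ?h"
      unfolding e using v(2) h(1) by (rule mat_of_op_comp)
    moreover have "(seq.corank_one_idem e \<circ> ?h) x \<in> supported_below n" if "x \<in> supported_below n" for x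
      using corank_one_idem_supported_below[OF v(1) h(1)[OF that]] e by simp
    moreover have "foldr (\<lambda>e g. seq.corank_one_idem e \<circ> g) (e # es) id = seq.corank_one_idem e \<circ> ?h"
      by (simp only: foldr.simps o_apply)
    moreover have "foldr (*) (map (\<lambda>e. mat_of_op n (seq.corank_one_idem e)) (e # es)) (1\<^sub>m n)
        = mat_of_op n (seq.corank_one_idem e) * mat_of_op n ?h"
      by (simp only: foldr.simps o_apply list.map h(2))
    ultimately show ?case
      by (metis (no_types, lifting))
  qed
  then show ?thesis ..
qed

lemma corank_one_idem_mat:
  assumes v: "v \<in> supported_below n" and \<phi>: "seq.functional \<phi>" "\<phi> v = 1"
  defines "E \<equiv> mat_of_op n (seq.corank_one_idem (v, \<phi>))"
  shows "idempotent_mat n E" and "mat_rank E = n - 1"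
proof -
  have "seq.corank_one_idem (v, \<phi>) \<circ> seq.corank_one_idem (v, \<phi>) = seq.corank_one_idem (v, \<phi>)"
    using \<phi> by (auto simp: fun_eq_iff seq.corank_one_idem_def seq.functional_diff seq.functional_smul)
  then have "E * E = E"
    unfolding E_def by (metis mat_of_op_comp[OF \<phi>(1)] corank_one_idem_supported_below[OF v])
  then show "idempotent_mat n E"
    by (simp add: idempotent_mat_def E_def mat_of_op_def)
  show "mat_rank E = n - 1"
    unfolding E_def mat_of_op_corank_one_idem
    using functional_supported_below[OF \<phi>(1) v] \<phi>(2) by (intro mat_rank_id_minus_rank_one) simp
qed

theorem corollary5p10:
  fixes n :: nat and A :: "'a::division_ring mat"
  assumes "n > 0"
    and "singular_mat n A"
  shows "\<exists>Es :: 'a mat list. length Es \<le> n \<and>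
           (\<forall>E \<in> set Es. idempotent_mat n E \<and> mat_rank E = n - 1) \<and>
           A = foldr (*) Es (1\<^sub>m n)"
proof -
  have A: "A \<in> carrier_mat n n"
    using assms(2) by (auto simp: singular_mat_def zero_divisor_def ring_mat_def)
  obtain x where x: "\<exists>j<n. x j \<noteq> 0" "\<forall>i<n. (\<Sum>j<n. A $$ (i, j) * x j) = 0"
    using singular_mat_kernel[OF assms(2)] by blast
  \<comment> \<open>The kernel vector is extended by zero, since \<open>T\<close> below is the
    identity on the coordinates from \<open>n\<close> on.\<close>
  define u where "u i = (if i < n then x i else 0)" for i
  \<comment> \<open>These are the columns of \<open>1 - A\<close>, extended by zero. Paired with the
    \<open>n\<close> coordinate functionals, they make \<open>T\<close> act as \<open>A\<close> on
    the first \<open>n\<close> coordinates.\<close>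
  define p where "p l = (\<lambda>i. if i < n then (if i = l then 1 else 0) - A $$ (i, l) else 0)" for l
  define T where "T = seq.id_minus {..<n} p (\<lambda>l y. y l)"
  have T: "T y i = y i - (\<Sum>l<n. p l i * y l)" for y i
    by (simp add: T_def seq.id_minus_def sum_fun_apply seq_smul_def)
  have p_supported: "p l \<in> supported_below n" for l
    by (simp add: p_def supported_below_def)
  have "T u = 0"
  proof
    fix i
    show "T u i = 0 i"
    proof (cases "i < n")
      case True
      then have "(\<Sum>l<n. p l i * u l) = (\<Sum>l<n. (if i = l then x l else 0) - A $$ (i, l) * x l)"
        by (intro sum.cong) (auto simp: p_def u_def left_diff_distrib)
      also have "\<dots> = x i"
        using True x(2) by (simp add: sum_subtractf)
      finally show ?thesis
        using True by (simp add: T u_def)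
    qed (simp add: T u_def p_def)
  qed
  moreover have "u \<noteq> 0"
    using x(1) by (auto simp: u_def fun_eq_iff)
  ultimately obtain es where es: "length es \<le> n"
    "\<forall>(v, \<phi>) \<in> set es. v \<in> supported_below n \<and> seq.functional \<phi> \<and> \<phi> v = 1"
    "T = foldr (\<lambda>e g. seq.corank_one_idem e \<circ> g) es id"
    using seq.singular_product_of_corank_one_idem[of "{..<n}" "\<lambda>l y. y l" "supported_below n" p u]
      functional_coordinate p_supported subspace_supported_below[of n]
    unfolding T_def by auto
  have "mat_of_op n T = A"
  proof (rule eq_matI)
    fix i j assume "i < dim_row A" "j < dim_col A"
    then have ij: "i < n" "j < n" using A by auto
    have "(\<Sum>l<n. p l i * unit_seq j l) = (\<Sum>l<n. if j = l then p l i else 0)"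
      by (intro sum.cong) (auto simp: unit_seq_def)
    then show "mat_of_op n T $$ (i, j) = A $$ (i, j)"
      using ij by (simp add: mat_of_op_def T) (simp add: p_def unit_seq_def)
  qed (use A in \<open>auto simp: mat_of_op_def\<close>)
  moreover have "mat_of_op n T
      = foldr (*) (map (\<lambda>e. mat_of_op n (seq.corank_one_idem e)) es) (1\<^sub>m n)"
    unfolding es(3) by (rule mat_of_op_foldr) (use es(2) in auto)
  moreover have "idempotent_mat n (mat_of_op n (seq.corank_one_idem e)) \<and>
      mat_rank (mat_of_op n (seq.corank_one_idem e)) = n - 1" if "e \<in> set es" for e
    using es(2) that corank_one_idem_mat[of "fst e" n "snd e"] by fastforce
  ultimately show ?thesis
    using es(1)
    by (intro exI[of _ "map (\<lambda>e. mat_of_op n (seq.corank_one_idem e)) es"]) auto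
qed

end
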